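(* Let $a>0$ and let $z\in\mathbb{C}\setminus[-1,1]$ belong to the resolvent set of $H_a$. Then the resolvent $R_a(z)=(H_a-zI)^{-1}$ satisfies $$(R_a(z)e_0,e_0)=-\frac{2\omega(z)}{D_a(z)}=\frac{2\omega(z)}{(a^2-1)\omega(z)^2-1}=\frac{2}{(a^2-2)z-a^2\sqrt{z^2-1}}.$$
   Context: $\mathbb{Z}_+=\{0,1,2,\dots\}$ and $(e_n)_{n\ge0}$ is the canonical orthonormal basis of $\ell^2(\mathbb{Z}_+)$. For $a>0$, $H_a$ is the bounded self-adjoint operator on $\ell^2(\mathbb{Z}_+)$ given by $$H_ae_0=\tfrac a2e_1,\qquad H_ae_1=\tfrac12(ae_0+e_2),\qquad H_ae_n=\tfrac12(e_{n-1}+e_{n+1})\ \ (n\ge2).$$ The branch of $\sqrt{z^2-1}$ is analytic on $\mathbb{C}\setminus[-1,1]$ and positive for $z>1$ (so negative for $z<-1$). Put $\omega(z)=z-\sqrt{z^2-1}$ and $D_a(z)=1+(1-a^2)\omega(z)^2$. *)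

theory Defs
  imports "HOL-Analysis.Analysis"
begin

section \<open>The space of complex square-summable sequences\<close>

typedef ell2 = "{x :: nat \<Rightarrow> complex. summable (\<lambda>n. (cmod (x n))\<^sup>2)}"
  morphisms coord Abs_ell2
  by (rule exI[of _ "\<lambda>_. 0"]) simp

setup_lifting type_definition_ell2

lemma summable_coord: "summable (\<lambda>n. (cmod (coord x n))\<^sup>2)"
  using coord[of x] by simp

lemma ell2_eqI: "(\<And>n. coord x n = coord y n) \<Longrightarrow> x = y"
  by (simp add: coord_inject[symmetric] fun_eq_iff)

lemma square_summable_add:
  fixes x y :: "nat \<Rightarrow> complex"
  assumes "summable (\<lambda>n. (cmod (x n))\<^sup>2)" "summable (\<lambda>n. (cmod (y n))\<^sup>2)"
  shows "summable (\<lambda>n. (cmod (x n + y n))\<^sup>2)"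
proof (rule summable_comparison_test'[where N = 0])
  show "summable (\<lambda>n. 2 * (cmod (x n))\<^sup>2 + 2 * (cmod (y n))\<^sup>2)"
    by (intro summable_add summable_mult assms)
  fix n
  have "(cmod (x n + y n))\<^sup>2 \<le> (cmod (x n) + cmod (y n))\<^sup>2"
    by (intro power_mono norm_triangle_ineq) auto
  also have "\<dots> \<le> 2 * (cmod (x n))\<^sup>2 + 2 * (cmod (y n))\<^sup>2"
    using zero_le_power2[of "cmod (x n) - cmod (y n)"]
    by (simp add: power2_eq_square algebra_simps)
  finally show "norm ((cmod (x n + y n))\<^sup>2) \<le> 2 * (cmod (x n))\<^sup>2 + 2 * (cmod (y n))\<^sup>2"
    by simp
qed

lemma square_summable_mult:
  fixes x :: "nat \<Rightarrow> complex"
  assumes "summable (\<lambda>n. (cmod (x n))\<^sup>2)"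
  shows "summable (\<lambda>n. (cmod (c * x n))\<^sup>2)"
  using summable_mult[OF assms, of "(cmod c)\<^sup>2"] by (simp add: norm_mult power_mult_distrib)

lemma summable_mult_cnj:
  fixes x y :: "nat \<Rightarrow> complex"
  assumes "summable (\<lambda>n. (cmod (x n))\<^sup>2)" "summable (\<lambda>n. (cmod (y n))\<^sup>2)"
  shows "summable (\<lambda>n. x n * cnj (y n))"
proof (rule summable_comparison_test'[where N = 0])
  show "summable (\<lambda>n. (cmod (x n))\<^sup>2 + (cmod (y n))\<^sup>2)"
    by (intro summable_add assms)
  fix n
  have "2 * (cmod (x n) * cmod (y n)) \<le> (cmod (x n))\<^sup>2 + (cmod (y n))\<^sup>2"
    using sum_squares_bound[of "cmod (x n)" "cmod (y n)"] by simp
  moreover have "0 \<le> cmod (x n) * cmod (y n)" by simp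
  ultimately show "norm (x n * cnj (y n)) \<le> (cmod (x n))\<^sup>2 + (cmod (y n))\<^sup>2"
    unfolding norm_mult complex_mod_cnj by linarith
qed

instantiation ell2 :: real_vector
begin

lift_definition zero_ell2 :: ell2 is "\<lambda>_. 0" by simp

lift_definition plus_ell2 :: "ell2 \<Rightarrow> ell2 \<Rightarrow> ell2" is "\<lambda>x y n. x n + y n"
  by (rule square_summable_add)

lift_definition uminus_ell2 :: "ell2 \<Rightarrow> ell2" is "\<lambda>x n. - x n" by simp

lift_definition minus_ell2 :: "ell2 \<Rightarrow> ell2 \<Rightarrow> ell2" is "\<lambda>x y n. x n - y n"
  using square_summable_add[of _ "\<lambda>n. - _ n"] by simp

lift_definition scaleR_ell2 :: "real \<Rightarrow> ell2 \<Rightarrow> ell2" is "\<lambda>r x n. complex_of_real r * x n"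
  by (rule square_summable_mult)

instance
  by standard (transfer; auto simp: algebra_simps fun_eq_iff)+

end

lift_definition scaleC :: "complex \<Rightarrow> ell2 \<Rightarrow> ell2" (infixr "*\<^sub>C" 75) is "\<lambda>c x n. c * x n"
  by (rule square_summable_mult)

text \<open>The inner product is linear in its first argument.\<close>

definition cinner :: "ell2 \<Rightarrow> ell2 \<Rightarrow> complex" where
  "cinner x y = (\<Sum>n. coord x n * cnj (coord y n))"

lemma coord_simps [simp]:
  "coord 0 n = 0"
  "coord (x + y) n = coord x n + coord y n"
  "coord (- x) n = - coord x n"
  "coord (x - y) n = coord x n - coord y n"
  "coord (r *\<^sub>R x) n = complex_of_real r * coord x n"
  "coord (c *\<^sub>C x) n = c * coord x n"
  by (transfer; simp)+

lemma summable_cinner: "summable (\<lambda>n. coord x n * cnj (coord y n))"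
  by (intro summable_mult_cnj summable_coord)

lemma cinner_self: "cinner x x = complex_of_real (\<Sum>n. (cmod (coord x n))\<^sup>2)"
  unfolding cinner_def
  by (simp add: complex_norm_square[symmetric] suminf_of_real[OF summable_coord] del: of_real_power)

lemma cinner_commute: "cinner x y = cnj (cinner y x)"
proof -
  have "(\<lambda>n. cnj (coord y n * cnj (coord x n))) sums cnj (cinner y x)"
    unfolding cinner_def by (simp only: sums_cnj) (rule summable_sums[OF summable_cinner])
  then show ?thesis
    unfolding cinner_def by (simp add: sums_iff mult.commute)
qed

lemma cinner_add_left: "cinner (x + y) z = cinner x z + cinner y z"
  unfolding cinner_def by (simp add: algebra_simps suminf_add[OF summable_cinner summable_cinner])

lemma cinner_scaleC_left: "cinner (c *\<^sub>C x) y = c * cinner x y"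
  unfolding cinner_def by (simp add: suminf_mult[OF summable_cinner] mult.assoc)

lemma scaleR_scaleC: "r *\<^sub>R (x :: ell2) = complex_of_real r *\<^sub>C x"
  by (rule ell2_eqI) simp

text \<open>
  The library has no class of complex inner product spaces, so the norm and the topology come from
  the underlying real inner product; complex-linearity is stated through \<^term>\<open>scaleC\<close>.
\<close>

instantiation ell2 :: real_inner
begin

definition inner_ell2 :: "ell2 \<Rightarrow> ell2 \<Rightarrow> real" where
  "inner_ell2 x y = Re (cinner x y)"

definition norm_ell2 :: "ell2 \<Rightarrow> real" where
  "norm_ell2 x = sqrt (\<Sum>n. (cmod (coord x n))\<^sup>2)"

definition sgn_ell2 :: "ell2 \<Rightarrow> ell2" where
  "sgn_ell2 x = x /\<^sub>R norm x"

definition dist_ell2 :: "ell2 \<Rightarrow> ell2 \<Rightarrow> real" where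
  "dist_ell2 x y = norm (x - y)"

definition uniformity_ell2 :: "(ell2 \<times> ell2) filter" where
  "uniformity_ell2 = (INF e\<in>{0 <..}. principal {(x, y). dist x y < e})"

definition open_ell2 :: "ell2 set \<Rightarrow> bool" where
  "open_ell2 U \<longleftrightarrow> (\<forall>x\<in>U. eventually (\<lambda>(x', y). x' = x \<longrightarrow> y \<in> U) uniformity)"

instance
proof
  fix x y z :: ell2 and r :: real and U :: "ell2 set"
  show "dist x y = norm (x - y)" by (rule dist_ell2_def)
  show "sgn x = x /\<^sub>R norm x" by (rule sgn_ell2_def)
  show "uniformity = (INF e\<in>{0 <..}. principal {(x :: ell2, y). dist x y < e})"
    by (rule uniformity_ell2_def)
  show "open U \<longleftrightarrow> (\<forall>x\<in>U. eventually (\<lambda>(x', y). x' = x \<longrightarrow> y \<in> U) uniformity)"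
    by (rule open_ell2_def)
  show "inner x y = inner y x"
    unfolding inner_ell2_def by (subst cinner_commute) simp
  show "inner (x + y) z = inner x z + inner y z"
    by (simp add: inner_ell2_def cinner_add_left)
  show "inner (r *\<^sub>R x) y = r * inner x y"
    by (simp add: inner_ell2_def scaleR_scaleC cinner_scaleC_left)
  show "0 \<le> inner x x"
    by (simp add: inner_ell2_def cinner_self suminf_nonneg[OF summable_coord])
  show "inner x x = 0 \<longleftrightarrow> x = 0"
  proof -
    have "inner x x = 0 \<longleftrightarrow> (\<forall>n. coord x n = 0)"
      using suminf_eq_zero_iff[OF summable_coord, of x] by (simp add: inner_ell2_def cinner_self)
    also have "\<dots> \<longleftrightarrow> x = 0" by (auto intro: ell2_eqI)
    finally show ?thesis .
  qed
  show "norm x = sqrt (inner x x)"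
    by (simp add: norm_ell2_def inner_ell2_def cinner_self)
qed

end

lift_definition e_vec :: "nat \<Rightarrow> ell2" is "\<lambda>n k. if k = n then 1 else 0"
  by (rule summable_finite[of "{_}"]) auto

lemma coord_e [simp]: "coord (e_vec n) k = (if k = n then 1 else 0)"
  by transfer simp

lemma cinner_e_right: "cinner x (e_vec n) = coord x n"
proof -
  have "cinner x (e_vec n) = (\<Sum>k\<in>{n}. coord x k * cnj (coord (e_vec n) k))"
    unfolding cinner_def by (rule suminf_finite) auto
  then show ?thesis by simp
qed

lemma cinner_e_e: "cinner (e_vec m) (e_vec n) = (if m = n then 1 else 0)"
  by (simp add: cinner_e_right)

lemma norm_scaleC: "norm (c *\<^sub>C x) = cmod c * norm x"
proof -
  have "(\<Sum>n. (cmod (c * coord x n))\<^sup>2) = (cmod c)\<^sup>2 * (\<Sum>n. (cmod (coord x n))\<^sup>2)"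
    by (simp add: norm_mult power_mult_distrib suminf_mult[OF summable_coord])
  then show ?thesis
    by (simp add: norm_ell2_def real_sqrt_mult)
qed

lemma basis_expansion_tendsto: "(\<lambda>N. \<Sum>n<N. coord x n *\<^sub>C e_vec n) \<longlonglongrightarrow> x"
proof -
  let ?S = "\<Sum>n. (cmod (coord x n))\<^sup>2"
  have coord_sum: "coord (\<Sum>n<N. coord x n *\<^sub>C e_vec n) k = (if k < N then coord x k else 0)" for N k
    by (induction N) (auto simp: less_Suc_eq)
  have "norm ((\<Sum>n<N. coord x n *\<^sub>C e_vec n) - x) = sqrt (?S - (\<Sum>n<N. (cmod (coord x n))\<^sup>2))" for N
  proof -
    have "(\<lambda>k. (cmod (coord x k))\<^sup>2 - (if k \<in> {..<N} then (cmod (coord x k))\<^sup>2 else 0))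
        sums (?S - (\<Sum>n<N. (cmod (coord x n))\<^sup>2))"
      by (intro sums_diff summable_sums summable_coord sums_If_finite_set) simp
    moreover have "(\<lambda>k. (cmod (coord x k))\<^sup>2 - (if k \<in> {..<N} then (cmod (coord x k))\<^sup>2 else 0)) =
        (\<lambda>k. (cmod (coord ((\<Sum>n<N. coord x n *\<^sub>C e_vec n) - x) k))\<^sup>2)"
      by (auto simp: coord_sum)
    ultimately show ?thesis
      by (simp add: norm_ell2_def sums_iff)
  qed
  moreover have "(\<lambda>N. sqrt (?S - (\<Sum>n<N. (cmod (coord x n))\<^sup>2))) \<longlonglongrightarrow> sqrt (?S - ?S)"
    by (intro tendsto_intros summable_LIMSEQ summable_coord)
  ultimately have "(\<lambda>N. norm ((\<Sum>n<N. coord x n *\<^sub>C e_vec n) - x)) \<longlonglongrightarrow> 0"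
    by simp
  then show ?thesis
    by (simp add: tendsto_norm_zero_iff Lim_null[of _ x])
qed

lemma bounded_linear_eq_on_basis:
  fixes f g :: "ell2 \<Rightarrow> 'a :: real_normed_vector"
  assumes f: "bounded_linear f" and g: "bounded_linear g"
    and eq: "\<And>c n. f (c *\<^sub>C e_vec n) = g (c *\<^sub>C e_vec n)"
  shows "f = g"
proof
  fix x
  let ?p = "\<lambda>N. \<Sum>n<N. coord x n *\<^sub>C e_vec n"
  have "(\<lambda>N. f (?p N)) \<longlonglongrightarrow> f x" "(\<lambda>N. g (?p N)) \<longlonglongrightarrow> g x"
    by (intro bounded_linear.tendsto[OF f] bounded_linear.tendsto[OF g] basis_expansion_tendsto)+
  moreover have "f (?p N) = g (?p N)" for N
    by (simp add: linear_sum bounded_linear.linear f g eq)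
  ultimately show "f x = g x"
    using LIMSEQ_unique by simp
qed

lemma bounded_linear_cinner_left: "bounded_linear (\<lambda>x. cinner x y)"
proof (rule bounded_linear_intro[where K = "2 * norm y"])
  fix x z :: ell2 and r :: real
  show "cinner (x + z) y = cinner x y + cinner z y" by (rule cinner_add_left)
  show "cinner (r *\<^sub>R x) y = r *\<^sub>R cinner x y"
    by (simp add: scaleR_scaleC cinner_scaleC_left scaleR_conv_of_real)
  have "\<bar>Re (cinner x y)\<bar> \<le> norm x * norm y"
    using Cauchy_Schwarz_ineq2[of x y] by (simp add: inner_ell2_def)
  moreover have "\<bar>Im (cinner x y)\<bar> \<le> norm x * norm y"
    using Cauchy_Schwarz_ineq2[of "(- \<i>) *\<^sub>C x" y]
    by (simp add: inner_ell2_def cinner_scaleC_left norm_scaleC)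
  ultimately show "norm (cinner x y) \<le> norm x * (2 * norm y)"
    using cmod_le[of "cinner x y"] by (simp add: algebra_simps)
qed

section \<open>Bounded operators, resolvent set and resolvent\<close>

definition bounded_clinear :: "(ell2 \<Rightarrow> ell2) \<Rightarrow> bool" where
  "bounded_clinear T \<longleftrightarrow> bounded_linear T \<and> (\<forall>c x. T (c *\<^sub>C x) = c *\<^sub>C T x)"

definition resolvent_set :: "(ell2 \<Rightarrow> ell2) \<Rightarrow> complex set" where
  "resolvent_set T =
    {z. \<exists>R. bounded_clinear R \<and> (\<forall>x. R (T x - z *\<^sub>C x) = x) \<and> (\<forall>x. T (R x) - z *\<^sub>C R x = x)}"

text \<open>Only meaningful for \<open>z\<close> in the resolvent set.\<close>

definition resolvent :: "(ell2 \<Rightarrow> ell2) \<Rightarrow> complex \<Rightarrow> ell2 \<Rightarrow> ell2" where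
  "resolvent T z = inv (\<lambda>x. T x - z *\<^sub>C x)"

lemma resolvent_inverse:
  assumes "z \<in> resolvent_set T"
  shows "bounded_clinear (resolvent T z)"
    and "resolvent T z (T x - z *\<^sub>C x) = x"
    and "T (resolvent T z x) - z *\<^sub>C resolvent T z x = x"
proof -
  obtain R where R: "bounded_clinear R" "\<And>x. R (T x - z *\<^sub>C x) = x"
    "\<And>x. T (R x) - z *\<^sub>C R x = x"
    using assms unfolding resolvent_set_def by blast
  have "resolvent T z = R"
    unfolding resolvent_def by (rule inv_equality) (use R in auto)
  with R show "bounded_clinear (resolvent T z)"
    and "resolvent T z (T x - z *\<^sub>C x) = x"
    and "T (resolvent T z x) - z *\<^sub>C resolvent T z x = x" by auto
qed

section \<open>The operator \<open>H\<^sub>a\<close>\<close>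

lemma square_summable_shift:
  fixes x :: "nat \<Rightarrow> complex"
  assumes x: "summable (\<lambda>n. (cmod (x n))\<^sup>2)"
  defines "y \<equiv> \<lambda>n. case n of 0 \<Rightarrow> 0 | Suc k \<Rightarrow> x k"
  shows "summable (\<lambda>n. (cmod (x (Suc n)))\<^sup>2)"
    and "(\<Sum>n. (cmod (x (Suc n)))\<^sup>2) \<le> (\<Sum>n. (cmod (x n))\<^sup>2)"
    and "summable (\<lambda>n. (cmod (y n))\<^sup>2)"
    and "(\<Sum>n. (cmod (y n))\<^sup>2) = (\<Sum>n. (cmod (x n))\<^sup>2)"
proof -
  show "summable (\<lambda>n. (cmod (x (Suc n)))\<^sup>2)"
    using x by (subst summable_Suc_iff)
  show "(\<Sum>n. (cmod (x (Suc n)))\<^sup>2) \<le> (\<Sum>n. (cmod (x n))\<^sup>2)"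
    using suminf_split_head[OF x] by simp
  have "(\<lambda>n. (cmod (y (Suc n)))\<^sup>2) = (\<lambda>n. (cmod (x n))\<^sup>2)"
    by (simp add: y_def)
  then show y: "summable (\<lambda>n. (cmod (y n))\<^sup>2)"
    using x by (subst summable_Suc_iff[symmetric]) simp
  show "(\<Sum>n. (cmod (y n))\<^sup>2) = (\<Sum>n. (cmod (x n))\<^sup>2)"
    using suminf_split_head[OF y] by (simp add: y_def)
qed

text \<open>
  Coefficientwise description of \<open>H\<^sub>a\<close>; \<open>H_unique\<close> below shows that \<open>H a\<close> is the bounded operator
  determined by its values on the basis.
\<close>

definition H_seq :: "real \<Rightarrow> (nat \<Rightarrow> complex) \<Rightarrow> nat \<Rightarrow> complex" where
  "H_seq a x n =
    (if n = 0 then complex_of_real a / 2 * x 1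
     else if n = 1 then (complex_of_real a * x 0 + x 2) / 2
     else (x (n - 1) + x (n + 1)) / 2)"

lemma H_seq_bound:
  "(cmod (H_seq a x n))\<^sup>2 \<le>
    (1 + \<bar>a\<bar>)\<^sup>2 / 2 * ((cmod (case n of 0 \<Rightarrow> 0 | Suc k \<Rightarrow> x k))\<^sup>2 + (cmod (x (Suc n)))\<^sup>2)"
proof -
  define M where "M = 1 + \<bar>a\<bar>"
  define u where "u = (case n of 0 \<Rightarrow> 0 | Suc k \<Rightarrow> x k)"
  obtain s t where st: "H_seq a x n = (complex_of_real s * u + complex_of_real t * x (Suc n)) / 2"
    and "\<bar>s\<bar> \<le> M" "\<bar>t\<bar> \<le> M"
  proof -
    consider "n = 0" | "n = 1" | k where "n = Suc (Suc k)"
      by (metis One_nat_def not0_implies_Suc)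
    then show ?thesis
    proof cases
      case 1 then show ?thesis by (intro that[of 0 a]) (auto simp: H_seq_def u_def M_def)
    next
      case 2 then show ?thesis
        by (intro that[of a 1]) (auto simp: H_seq_def u_def M_def numeral_2_eq_2)
    next
      case 3 then show ?thesis by (intro that[of 1 1]) (auto simp: H_seq_def u_def M_def)
    qed
  qed
  have "cmod (H_seq a x n) \<le> (\<bar>s\<bar> * cmod u + \<bar>t\<bar> * cmod (x (Suc n))) / 2"
    using norm_triangle_ineq[of "complex_of_real s * u" "complex_of_real t * x (Suc n)"]
    by (simp add: st norm_divide norm_mult)
  also have "\<dots> \<le> (M * cmod u + M * cmod (x (Suc n))) / 2"
    using \<open>\<bar>s\<bar> \<le> M\<close> \<open>\<bar>t\<bar> \<le> M\<close> by (intro divide_right_mono add_mono mult_right_mono) auto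
  finally have "(cmod (H_seq a x n))\<^sup>2 \<le> ((M * cmod u + M * cmod (x (Suc n))) / 2)\<^sup>2"
    by (intro power_mono) auto
  also have "\<dots> = M\<^sup>2 / 4 * (cmod u + cmod (x (Suc n)))\<^sup>2"
    by (simp add: power2_eq_square algebra_simps)
  also have "\<dots> \<le> M\<^sup>2 / 4 * (2 * ((cmod u)\<^sup>2 + (cmod (x (Suc n)))\<^sup>2))"
    using zero_le_power2[of "cmod u - cmod (x (Suc n))"]
    by (intro mult_left_mono) (auto simp: power2_eq_square algebra_simps)
  also have "\<dots> = M\<^sup>2 / 2 * ((cmod u)\<^sup>2 + (cmod (x (Suc n)))\<^sup>2)" by simp
  finally show ?thesis unfolding M_def u_def .
qed

lemma H_seq_summable:
  assumes x: "summable (\<lambda>n. (cmod (x n))\<^sup>2)"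
  shows "summable (\<lambda>n. (cmod (H_seq a x n))\<^sup>2)"
    and "(\<Sum>n. (cmod (H_seq a x n))\<^sup>2) \<le> (1 + \<bar>a\<bar>)\<^sup>2 * (\<Sum>n. (cmod (x n))\<^sup>2)"
proof -
  define y where "y = (\<lambda>n. case n of 0 \<Rightarrow> 0 | Suc k \<Rightarrow> x k)"
  note shift = square_summable_shift[OF x, folded y_def]
  have bound: "(cmod (H_seq a x n))\<^sup>2 \<le> (1 + \<bar>a\<bar>)\<^sup>2 / 2 * ((cmod (y n))\<^sup>2 + (cmod (x (Suc n)))\<^sup>2)" for n
    using H_seq_bound[of a x n] by (simp add: y_def)
  have sum: "summable (\<lambda>n. (1 + \<bar>a\<bar>)\<^sup>2 / 2 * ((cmod (y n))\<^sup>2 + (cmod (x (Suc n)))\<^sup>2))"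
    by (intro summable_mult summable_add shift)
  show H: "summable (\<lambda>n. (cmod (H_seq a x n))\<^sup>2)"
    by (rule summable_comparison_test'[OF sum, where N = 0]) (use bound in simp)
  have "(\<Sum>n. (cmod (H_seq a x n))\<^sup>2) \<le>
      (\<Sum>n. (1 + \<bar>a\<bar>)\<^sup>2 / 2 * ((cmod (y n))\<^sup>2 + (cmod (x (Suc n)))\<^sup>2))"
    by (rule suminf_le[OF bound H sum])
  also have "\<dots> = (1 + \<bar>a\<bar>)\<^sup>2 / 2 * ((\<Sum>n. (cmod (y n))\<^sup>2) + (\<Sum>n. (cmod (x (Suc n)))\<^sup>2))"
    by (simp only: suminf_add[OF shift(3) shift(1)] suminf_mult[OF summable_add[OF shift(3) shift(1)]])
  also have "\<dots> \<le> (1 + \<bar>a\<bar>)\<^sup>2 / 2 * ((\<Sum>n. (cmod (x n))\<^sup>2) + (\<Sum>n. (cmod (x n))\<^sup>2))"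
    using shift by (intro mult_left_mono add_mono) auto
  finally show "(\<Sum>n. (cmod (H_seq a x n))\<^sup>2) \<le> (1 + \<bar>a\<bar>)\<^sup>2 * (\<Sum>n. (cmod (x n))\<^sup>2)"
    by simp
qed

lift_definition H :: "real \<Rightarrow> ell2 \<Rightarrow> ell2" is H_seq
  by (rule H_seq_summable)

lemma coord_H: "coord (H a x) n = H_seq a (coord x) n"
  by transfer simp

lemma bounded_clinear_H: "bounded_clinear (H a)"
  unfolding bounded_clinear_def
proof (intro conjI allI)
  show "bounded_linear (H a)"
  proof (rule bounded_linear_intro[where K = "1 + \<bar>a\<bar>"])
    fix x y :: ell2 and r :: real
    show "H a (x + y) = H a x + H a y"
      by (rule ell2_eqI) (simp add: coord_H H_seq_def field_simps)
    show "H a (r *\<^sub>R x) = r *\<^sub>R H a x"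
      by (rule ell2_eqI) (simp add: coord_H H_seq_def field_simps)
    have "norm (H a x) \<le> sqrt ((1 + \<bar>a\<bar>)\<^sup>2 * (\<Sum>n. (cmod (coord x n))\<^sup>2))"
      unfolding norm_ell2_def coord_H by (intro real_sqrt_le_mono H_seq_summable summable_coord)
    then show "norm (H a x) \<le> norm x * (1 + \<bar>a\<bar>)"
      by (simp add: norm_ell2_def real_sqrt_mult mult.commute)
  qed
  show "H a (c *\<^sub>C x) = c *\<^sub>C H a x" for c x
    by (rule ell2_eqI) (simp add: coord_H H_seq_def field_simps)
qed

lemma H_basis:
  shows "H a (e_vec 0) = complex_of_real (a / 2) *\<^sub>C e_vec 1"
    and "H a (e_vec 1) = (1 / 2) *\<^sub>C (complex_of_real a *\<^sub>C e_vec 0 + e_vec 2)"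
    and "n \<ge> 2 \<Longrightarrow> H a (e_vec n) = (1 / 2) *\<^sub>C (e_vec (n - 1) + e_vec (n + 1))"
  by (rule ell2_eqI; auto simp: coord_H H_seq_def)+

lemma H_unique:
  assumes T: "bounded_clinear T"
    and T0: "T (e_vec 0) = complex_of_real (a / 2) *\<^sub>C e_vec 1"
    and T1: "T (e_vec 1) = (1 / 2) *\<^sub>C (complex_of_real a *\<^sub>C e_vec 0 + e_vec 2)"
    and T2: "\<And>n. n \<ge> 2 \<Longrightarrow> T (e_vec n) = (1 / 2) *\<^sub>C (e_vec (n - 1) + e_vec (n + 1))"
  shows "T = H a"
proof (rule bounded_linear_eq_on_basis)
  show "bounded_linear T" "bounded_linear (H a)"
    using T bounded_clinear_H by (auto simp: bounded_clinear_def)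
  fix c and n :: nat
  consider "n = 0" | "n = 1" | "n \<ge> 2" by linarith
  then have "T (e_vec n) = H a (e_vec n)"
    by cases (simp_all only: T0 T1 T2 H_basis)
  then show "T (c *\<^sub>C e_vec n) = H a (c *\<^sub>C e_vec n)"
    using T bounded_clinear_H[of a] by (simp add: bounded_clinear_def)
qed

lemma H_self_adjoint: "cinner (H a x) y = cinner x (H a y)"
proof -
  have H: "bounded_linear (H a)" "\<And>c x. H a (c *\<^sub>C x) = c *\<^sub>C H a x"
    using bounded_clinear_H by (auto simp: bounded_clinear_def)
  have e_left: "cinner (e_vec n) z = cnj (coord z n)" for n z
    by (subst cinner_commute) (simp add: cinner_e_right)
  have e: "cinner (H a (e_vec n)) y = cinner (e_vec n) (H a y)" for n
  proof -
    consider "n = 0" | "n = 1" | "n \<ge> 2" by linarith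
    then show ?thesis
      by cases (simp_all only: H_basis cinner_scaleC_left cinner_add_left e_left,
          simp_all add: coord_H H_seq_def)
  qed
  have "(\<lambda>x. cinner (H a x) y) = (\<lambda>x. cinner x (H a y))"
    by (rule bounded_linear_eq_on_basis)
      (auto intro: bounded_linear_compose[OF bounded_linear_cinner_left H(1)]
        bounded_linear_cinner_left simp: H(2) cinner_scaleC_left e)
  then show ?thesis by (rule fun_cong)
qed

section \<open>The branch of the square root\<close>

text \<open>
  The principal branch of \<open>\<surd>(1 - 1/z\<^sup>2)\<close> is analytic off \<open>[-1,1]\<close>, so this is the branch of
  \<open>\<surd>(z\<^sup>2 - 1)\<close> that is analytic on \<open>\<complex> \<setminus> [-1,1]\<close> and positive on \<open>(1,\<infinity>)\<close>; see the lemmas below.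
\<close>

definition sqrt_branch :: "complex \<Rightarrow> complex" where
  "sqrt_branch z = z * csqrt (1 - 1 / z\<^sup>2)"

abbreviation slit :: "complex set" where
  "slit \<equiv> complex_of_real ` {-1..1}"

lemma sqrt_branch_holomorphic: "sqrt_branch holomorphic_on - slit"
proof -
  have nz: "z \<noteq> 0" if "z \<in> - slit" for z
    using that by (force simp: image_iff)
  have "1 - 1 / z\<^sup>2 \<notin> \<real>\<^sub>\<le>\<^sub>0" if z: "z \<in> - slit" for z
  proof
    assume "1 - 1 / z\<^sup>2 \<in> \<real>\<^sub>\<le>\<^sub>0"
    then obtain r where r: "r \<le> 0" "1 - 1 / z\<^sup>2 = complex_of_real r"
      by (auto elim!: nonpos_Reals_cases)
    define q where "q = sqrt (1 / (1 - r))"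
    have q: "0 \<le> q" "q \<le> 1"
      using r(1) by (auto simp: q_def)
    have "z\<^sup>2 * complex_of_real (1 - r) = 1"
      using r(2) nz[OF z] by (simp add: field_simps flip: r(2))
    then have "z\<^sup>2 = complex_of_real (1 / (1 - r))"
      using r(1) by (simp add: of_real_divide nonzero_eq_divide_eq del: of_real_diff)
    also have "\<dots> = (complex_of_real q)\<^sup>2"
      using r(1) by (simp add: q_def flip: of_real_power)
    finally have "z = complex_of_real q \<or> z = complex_of_real (- q)"
      by (simp add: power2_eq_iff)
    then show False
    proof
      assume "z = complex_of_real q"
      moreover have "q \<in> {-1..1}" using q by simp
      ultimately show False using z by blast
    next
      assume "z = complex_of_real (- q)"
      moreover have "- q \<in> {-1..1}" using q by simp
      ultimately show False using z by blast
    qed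
  qed
  then show ?thesis
    unfolding sqrt_branch_def using nz by (auto intro!: holomorphic_intros)
qed

lemma sqrt_branch_square: "z \<noteq> 0 \<Longrightarrow> (sqrt_branch z)\<^sup>2 = z\<^sup>2 - 1"
  by (simp add: sqrt_branch_def power_mult_distrib right_diff_distrib)

lemma sqrt_branch_of_real:
  assumes "1 < \<bar>x\<bar>"
  shows "sqrt_branch (complex_of_real x) = complex_of_real (sgn x * sqrt (x\<^sup>2 - 1))"
proof -
  have x: "1 < x\<^sup>2" using assms one_less_power[of "\<bar>x\<bar>" 2] by simp
  have "csqrt (1 - 1 / (complex_of_real x)\<^sup>2) = csqrt (complex_of_real (1 - 1 / x\<^sup>2))" by simp
  also have "\<dots> = complex_of_real (sqrt (1 - 1 / x\<^sup>2))"
    using x by (subst csqrt_of_real_nonneg) (auto simp: divide_le_eq_1)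
  also have "1 - 1 / x\<^sup>2 = (x\<^sup>2 - 1) / x\<^sup>2" using assms by (auto simp: field_simps)
  also have "sqrt \<dots> = sqrt (x\<^sup>2 - 1) / \<bar>x\<bar>" by (simp add: real_sqrt_divide)
  finally show ?thesis
    using assms by (auto simp: sqrt_branch_def sgn_if)
qed

lemma sqrt_branch_unique:
  assumes f: "f holomorphic_on - slit"
    and sq: "\<And>z. z \<notin> slit \<Longrightarrow> (f z)\<^sup>2 = z\<^sup>2 - 1"
    and pos: "\<And>x :: real. x > 1 \<Longrightarrow> \<exists>r > 0. f (complex_of_real x) = complex_of_real r"
    and z: "z \<notin> slit"
  shows "f z = sqrt_branch z"
proof -
  have bb: "bounded slit" "convex slit"
    by (auto intro!: compact_imp_bounded compact_continuous_image continuous_intros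
        convex_linear_image simp: linear_iff scaleR_conv_of_real)
  have conn: "connected (- slit)"
    by (rule connected_complement_bounded_convex[OF bb]) simp
  have nz: "w \<noteq> 0" "w\<^sup>2 \<noteq> 1" if "w \<notin> slit" for w
    using that by (force simp: image_iff power2_eq_1_iff)+
  have nz': "sqrt_branch w \<noteq> 0" if "w \<notin> slit" for w
    using sqrt_branch_square[of w] nz[OF that] by auto
  define g where "g w = f w / sqrt_branch w" for w
  have g1: "g w = 1 \<or> g w = -1" if "w \<notin> slit" for w
  proof -
    have "(g w)\<^sup>2 = 1"
      using sq[OF that] sqrt_branch_square[of w] nz[OF that] nz'[OF that]
      by (simp add: g_def power_divide)
    then show ?thesis by (simp add: power2_eq_1_iff)
  qed
  have "g constant_on - slit"
  proof (rule continuous_discrete_range_constant[OF conn])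
    show "continuous_on (- slit) g"
      unfolding g_def using nz'
      by (intro continuous_intros holomorphic_on_imp_continuous_on f sqrt_branch_holomorphic) auto
    show "\<exists>e>0. \<forall>y. y \<in> - slit \<and> g y \<noteq> g x \<longrightarrow> e \<le> cmod (g y - g x)" if "x \<in> - slit" for x
    proof (intro exI[of _ 2] conjI allI impI)
      fix y assume "y \<in> - slit \<and> g y \<noteq> g x"
      then have "g x = 1 \<and> g y = -1 \<or> g x = -1 \<and> g y = 1"
        using g1[of x] g1[of y] that by auto
      then show "2 \<le> cmod (g y - g x)" by auto
    qed simp
  qed
  then obtain c where c: "\<And>w. w \<notin> slit \<Longrightarrow> g w = c"
    by (auto simp: constant_on_def)
  have two: "complex_of_real 2 \<notin> slit"
    by (simp add: image_iff del: of_real_numeral)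
  obtain r where r: "r > 0" "f (complex_of_real 2) = complex_of_real r"
    using pos[of 2] by auto
  have "g (complex_of_real 2) = complex_of_real (r / sqrt 3)"
    unfolding g_def r(2) by (subst sqrt_branch_of_real) auto
  moreover have "r / sqrt 3 > 0" using r(1) by simp
  ultimately have "Re (g (complex_of_real 2)) > 0"
    by (simp only: Re_complex_of_real)
  then have "g (complex_of_real 2) \<noteq> -1" by auto
  then have "g z = 1"
    using g1[OF two] c[OF two] c[OF z] by auto
  then show ?thesis
    using nz'[OF z] by (simp add: g_def)
qed

definition omega :: "complex \<Rightarrow> complex" where
  "omega z = z - sqrt_branch z"

definition D :: "real \<Rightarrow> complex \<Rightarrow> complex" where
  "D a z = 1 + (1 - (complex_of_real a)\<^sup>2) * (omega z)\<^sup>2"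

end

theory Submission
  imports Defs
begin

text \<open>
  Off the slit, \<open>\<omega>\<close> is the root of \<open>w\<^sup>2 - 2zw + 1 = 0\<close> inside the unit disc, so
  \<open>x = (1, a\<omega>, a\<omega>\<^sup>2, \<dots>)\<close> is square summable; it solves every row of
  \<open>(H\<^sub>a - z)x = c e\<^sub>0\<close> with \<open>c = (a\<^sup>2\<omega> - 2z)/2 = - D\<^sub>a(z)/(2\<omega>)\<close>. Since \<open>x \<noteq> 0\<close>, injectivity of
  \<open>H\<^sub>a - z\<close> forces \<open>c \<noteq> 0\<close>, and \<open>R\<^sub>a(z) e\<^sub>0 = x/c\<close> has \<open>0\<close>th coefficient \<open>1/c\<close>.
\<close>

lemma slit_nonzero: "z \<notin> slit \<Longrightarrow> z \<noteq> 0"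
  by (force simp: image_iff)

text \<open>\<open>z + sqrt_branch z\<close> is the other root of w^2 - 2zw + 1, and the product of
  the two roots is the constant term.\<close>

lemma omega_mult_other_root:
  assumes "z \<noteq> 0"
  shows "omega z * (z + sqrt_branch z) = 1"
  using sqrt_branch_square[OF assms]
  by (simp add: omega_def algebra_simps power2_eq_square)

lemma omega_nonzero: "z \<noteq> 0 \<Longrightarrow> omega z \<noteq> 0"
  using omega_mult_other_root[of z] by auto

lemma omega_quadratic:
  assumes "z \<noteq> 0"
  shows "(omega z)\<^sup>2 = 2 * z * omega z - 1"
proof -
  have "z + sqrt_branch z = 2 * z - omega z" by (simp add: omega_def)
  with omega_mult_other_root[OF assms] have "omega z * (2 * z - omega z) = 1" by simp
  then show ?thesis by (simp add: algebra_simps power2_eq_square)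
qed

text \<open>A principal root has real part \<ge> 0. Were it purely imaginary, it = i*t, then z^2 =
  1/(1 + t^2) would lie in (0,1], which puts z on the slit.\<close>

lemma Re_csqrt_pos:
  assumes z: "z \<notin> slit"
  shows "0 < Re (csqrt (1 - 1 / z\<^sup>2))"
proof (rule ccontr)
  define q where "q = csqrt (1 - 1 / z\<^sup>2)"
  define t where "t = Im q"
  assume "\<not> 0 < Re (csqrt (1 - 1 / z\<^sup>2))"
  then have "Re q = 0"
    using csqrt_principal[of "1 - 1 / z\<^sup>2"] by (auto simp: q_def)
  then have "q\<^sup>2 = - complex_of_real (t\<^sup>2)"
    by (auto simp: t_def complex_eq_iff power2_eq_square)
  moreover have "q\<^sup>2 = 1 - 1 / z\<^sup>2" by (simp add: q_def)
  ultimately have "1 / z\<^sup>2 = complex_of_real (1 + t\<^sup>2)"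
    by (simp add: algebra_simps)
  then have z2: "z\<^sup>2 = complex_of_real (1 / (1 + t\<^sup>2))"
    by (metis div_by_1 divide_divide_eq_right mult_1 of_real_1 of_real_divide)
  define r where "r = sqrt (1 / (1 + t\<^sup>2))"
  have "0 < 1 + t\<^sup>2" by (intro add_pos_nonneg) auto
  then have "0 \<le> 1 / (1 + t\<^sup>2)" "1 / (1 + t\<^sup>2) \<le> 1" by (simp_all add: pos_divide_le_eq)
  then have r: "0 \<le> r" "r \<le> 1" "r\<^sup>2 = 1 / (1 + t\<^sup>2)"
    by (simp_all only: r_def real_sqrt_ge_0_iff real_sqrt_le_1_iff real_sqrt_pow2)
  have "z\<^sup>2 = (complex_of_real r)\<^sup>2"
    using z2 r(3) by (metis of_real_power)
  then have "z = complex_of_real r \<or> z = complex_of_real (- r)"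
    by (simp add: power2_eq_iff)
  moreover have "r \<in> {-1..1}" "- r \<in> {-1..1}" using r by auto
  ultimately show False using z by blast
qed

text \<open>The two roots z(1 - q) and z(1 + q) have product 1, so the one of strictly smaller
  modulus lies inside the unit disc.\<close>

lemma cmod_omega_less_1:
  assumes z: "z \<notin> slit"
  shows "cmod (omega z) < 1"
proof -
  note z0 = slit_nonzero[OF z]
  define q where "q = csqrt (1 - 1 / z\<^sup>2)"
  \<comment> \<open>The two sides differ by 4 Re q.\<close>
  have "(cmod (1 - q))\<^sup>2 < (cmod (1 + q))\<^sup>2"
    using Re_csqrt_pos[OF z, folded q_def]
    unfolding cmod_power2 by (simp add: power2_eq_square algebra_simps)
  then have "cmod (1 - q) < cmod (1 + q)"
    by (rule power_less_imp_less_base) simp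
  moreover have "omega z = z * (1 - q)" "z + sqrt_branch z = z * (1 + q)"
    by (simp_all add: omega_def sqrt_branch_def q_def algebra_simps)
  ultimately have less: "cmod (omega z) < cmod (z + sqrt_branch z)"
    using z0 by (simp add: norm_mult)
  have prod: "cmod (omega z) * cmod (z + sqrt_branch z) = 1"
    using omega_mult_other_root[OF z0] by (metis norm_mult norm_one)
  show ?thesis
  proof (rule ccontr)
    assume "\<not> ?thesis"
    then have "1 * 1 < cmod (omega z) * cmod (z + sqrt_branch z)"
      using less by (intro mult_le_less_imp_less) auto
    with prod show False by simp
  qed
qed

text \<open>Entry 0 is 1 and not a, because row 1 of \<open>H_seq\<close> already weighs that entry
  by a.\<close>

definition decaying_seq :: "real \<Rightarrow> complex \<Rightarrow> nat \<Rightarrow> complex" where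
  "decaying_seq a w n = (if n = 0 then 1 else complex_of_real a * w ^ n)"

lemma square_summable_decaying_seq:
  assumes "cmod w < 1"
  shows "summable (\<lambda>n. (cmod (decaying_seq a w n))\<^sup>2)"
proof -
  have "(cmod w)\<^sup>2 < 1"
    using assms by (simp add: abs_square_less_1)
  then have "summable (\<lambda>n. a\<^sup>2 * (cmod w)\<^sup>2 * ((cmod w)\<^sup>2) ^ n)"
    by (intro summable_mult summable_geometric) simp
  \<comment> \<open>The shift drops the exceptional entry 0 and leaves a geometric series of ratio
    |w|^2.\<close>
  moreover have "(\<lambda>n. (cmod (decaying_seq a w (Suc n)))\<^sup>2) = (\<lambda>n. a\<^sup>2 * (cmod w)\<^sup>2 * ((cmod w)\<^sup>2) ^ n)"
    by (auto simp: decaying_seq_def norm_mult norm_power power_mult_distrib mult_ac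
        simp flip: power_mult)
  ultimately show ?thesis
    by (subst summable_Suc_iff[symmetric]) simp
qed

text \<open>Each row n \<ge> 1 is a multiple of 1 + w^2 - 2zw = 0; row 0 has no left neighbour and
  leaves the residue.\<close>

lemma H_seq_decaying_seq:
  assumes w: "w\<^sup>2 = 2 * z * w - 1"
  shows "H_seq a (decaying_seq a w) n - z * decaying_seq a w n =
    ((complex_of_real a)\<^sup>2 * w / 2 - z) * (if n = 0 then 1 else 0)"
proof -
  have root: "1 + w\<^sup>2 - 2 * z * w = 0"
    using w by simp
  consider "n = 0" | "n = 1" | k where "n = Suc (Suc k)"
    by (metis One_nat_def not0_implies_Suc)
  then show ?thesis
  proof cases
    case 1 then show ?thesis
      by (simp add: H_seq_def decaying_seq_def power2_eq_square)
  next
    case 2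
    have "H_seq a (decaying_seq a w) 1 - z * decaying_seq a w 1 =
        complex_of_real a / 2 * (1 + w\<^sup>2 - 2 * z * w)"
      by (simp add: H_seq_def decaying_seq_def algebra_simps add_divide_distrib)
    with 2 root show ?thesis by simp
  next
    case 3
    have "H_seq a (decaying_seq a w) n - z * decaying_seq a w n =
        complex_of_real a * w ^ Suc k / 2 * (1 + w\<^sup>2 - 2 * z * w)"
      using 3 by (simp add: H_seq_def decaying_seq_def algebra_simps add_divide_distrib power2_eq_square)
    with 3 root show ?thesis by simp
  qed
qed

lemma resolvent_e0:
  fixes a :: real and z :: complex
  defines "c \<equiv> (complex_of_real a)\<^sup>2 * omega z / 2 - z"
  assumes z: "z \<notin> slit" and res: "z \<in> resolvent_set (H a)"
  shows "c \<noteq> 0" and "cinner (resolvent (H a) z (e_vec 0)) (e_vec 0) = 1 / c"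
proof -
  define x where "x = Abs_ell2 (decaying_seq a (omega z))"
  have coord_x: "coord x = decaying_seq a (omega z)"
    unfolding x_def using square_summable_decaying_seq[OF cmod_omega_less_1[OF z]]
    by (simp add: Abs_ell2_inverse)
  have eq: "H a x - z *\<^sub>C x = c *\<^sub>C e_vec 0"
    using H_seq_decaying_seq[OF omega_quadratic[OF slit_nonzero[OF z]]]
    by (intro ell2_eqI) (simp add: coord_H coord_x c_def)
  note R = resolvent_inverse[OF res]
  have "c *\<^sub>C resolvent (H a) z (e_vec 0) = x"
    using R(1) R(2)[of x] by (simp add: eq bounded_clinear_def)
  then have "coord (c *\<^sub>C resolvent (H a) z (e_vec 0)) 0 = 1"
    by (simp add: coord_x decaying_seq_def)
  \<comment> \<open>This one product yields both c \<noteq> 0 and the value 1/c.\<close>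
  then have inv: "coord (resolvent (H a) z (e_vec 0)) 0 * c = 1" by (simp add: mult.commute)
  then show "c \<noteq> 0" by auto
  with inv show "cinner (resolvent (H a) z (e_vec 0)) (e_vec 0) = 1 / c"
    by (simp add: cinner_e_right nonzero_eq_divide_eq)
qed

text \<open>Replace 1 + \<omega>^2 by 2z\<omega> in 1 + \<omega>^2 - a^2 \<omega>^2.\<close>

lemma D_eq:
  assumes "z \<noteq> 0"
  shows "D a z = - (2 * omega z * ((complex_of_real a)\<^sup>2 * omega z / 2 - z))"
  using omega_quadratic[OF assms] by (simp add: D_def algebra_simps power2_eq_square)

theorem theorem3p10:
  fixes a :: real and z :: complex
  assumes "a > 0"
    and "z \<notin> complex_of_real ` {-1..1}"
    and "z \<in> resolvent_set (H a)"
  shows "D a z \<noteq> 0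
    \<and> (complex_of_real a ^ 2 - 1) * omega z ^ 2 - 1 \<noteq> 0
    \<and> (complex_of_real a ^ 2 - 2) * z - complex_of_real a ^ 2 * sqrt_branch z \<noteq> 0
    \<and> cinner (resolvent (H a) z (e_vec 0)) (e_vec 0) = - (2 * omega z / D a z)
    \<and> - (2 * omega z / D a z)
        = 2 * omega z / ((complex_of_real a ^ 2 - 1) * omega z ^ 2 - 1)
    \<and> 2 * omega z / ((complex_of_real a ^ 2 - 1) * omega z ^ 2 - 1)
        = 2 / ((complex_of_real a ^ 2 - 2) * z - complex_of_real a ^ 2 * sqrt_branch z)"
proof -
  define c where "c = (complex_of_real a)\<^sup>2 * omega z / 2 - z"
  note z0 = slit_nonzero[OF assms(2)]
  note w0 = omega_nonzero[OF z0]
  note res = resolvent_e0[OF assms(2,3), folded c_def]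
  \<comment> \<open>All three denominators are nonzero multiples of c, namely -2\<omega>c,
    2\<omega>c and 2c, so each fraction reduces to 1/c.\<close>
  have D: "D a z = - (2 * omega z * c)"
    unfolding c_def by (rule D_eq[OF z0])
  have E: "(complex_of_real a ^ 2 - 1) * omega z ^ 2 - 1 = 2 * omega z * c"
    using D by (simp add: D_def algebra_simps)
  have F: "(complex_of_real a ^ 2 - 2) * z - complex_of_real a ^ 2 * sqrt_branch z = 2 * c"
    by (simp add: c_def omega_def algebra_simps)
  show ?thesis
    unfolding D E F res(2) using w0 res(1) by simp
qed

end
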